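(* Let $Z1$ denote the first Zagreb index of a tree, and write $Z1(n)=Z1(\tau(n))$, where $\tau(n)$ is the rooted tree with Matula number $n$. Then for every positive integer $n$, $$Z1(n)=\begin{cases}0, & \text{if } n=1;\\ Z1(t)+2+2\Omega(t), & \text{if } n=p_t \text{ with } t\ge 1;\\ Z1(r)+Z1(s)-\Omega(r)^2-\Omega(s)^2+\Omega(n)^2, & \text{if } n=rs \text{ with } r,s\ge 2.\end{cases}$$
   Context: For $m\ge 1$ let $p_m$ denote the $m$-th prime ($p_1=2,p_2=3,p_3=5,\dots$). For a positive integer $n$, $\Omega(n)$ is the number of prime divisors of $n$ counted with multiplicity. Rooted trees are finite and considered up to isomorphism of rooted trees. The Matula number $\mu(T)$ of a rooted tree $T$ is defined recursively: $\mu(T)=1$ for the one-vertex tree; otherwise, if $T_1,\dots,T_d$ are the subtrees rooted at the vertices adjacent to the root of $T$, then $\mu(T)=p_{\mu(T_1)}p_{\mu(T_2)}\cdots p_{\mu(T_d)}$. The map $\mu$ is a bijection from rooted trees to positive integers, and $\tau(n)$ denotes the rooted tree with Matula number $n$. Equivalently: $\tau(1)$ is the one-vertex tree; $\tau(p_t)$ is obtained from $\tau(t)$ by adding a new vertex, which becomes the root, joined by an edge to the root of $\tau(t)$; and, for $r,s\ge 2$, $\tau(rs)$ is obtained from $\tau(r)$ and $\tau(s)$ by identifying their roots. For a statistic $S$ on rooted trees, $S(n)$ means $S(\tau(n))$. The degree $\deg(i)$ of a vertex $i$ is the number of edges incident with $i$. The first Zagreb index of a tree is $\sum_i \deg(i)^2$,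 the sum being over all vertices $i$. *)

theory Defs
  imports "HOL-Computational_Algebra.Primes" "HOL-Library.Infinite_Set"
begin

record 'a rgraph =
  verts :: "'a set"
  edges :: "'a set set"
  root :: 'a

definition adj_rel :: "'a set set \<Rightarrow> ('a \<times> 'a) set" where
  "adj_rel E = {(u, v). {u, v} \<in> E}"

definition simple_graph :: "'a set \<Rightarrow> 'a set set \<Rightarrow> bool" where
  "simple_graph V E \<longleftrightarrow> finite V \<and> (\<forall>e\<in>E. e \<subseteq> V \<and> card e = 2)"

definition connected_graph :: "'a set \<Rightarrow> 'a set set \<Rightarrow> bool" where
  "connected_graph V E \<longleftrightarrow> V \<noteq> {} \<and> (\<forall>u\<in>V. \<forall>v\<in>V. (u, v) \<in> (adj_rel E)\<^sup>*)"

definition is_cycle :: "'a set set \<Rightarrow> 'a list \<Rightarrow> bool" where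
  "is_cycle E xs \<longleftrightarrow> length xs \<ge> 3 \<and> distinct xs \<and>
     (\<forall>i. Suc i < length xs \<longrightarrow> {xs ! i, xs ! Suc i} \<in> E) \<and> {last xs, hd xs} \<in> E"

definition rooted_tree :: "'a rgraph \<Rightarrow> bool" where
  "rooted_tree T \<longleftrightarrow> simple_graph (verts T) (edges T) \<and> connected_graph (verts T) (edges T) \<and>
     (\<nexists>xs. is_cycle (edges T) xs) \<and> root T \<in> verts T"

text \<open>For a neighbour \<open>v\<close> of the root, the subtree rooted at \<open>v\<close> is the connected component
  of \<open>v\<close> after deletion of the root (and of the edges incident with it).\<close>

definition branch :: "'a rgraph \<Rightarrow> 'a \<Rightarrow> 'a rgraph" where
  "branch T v =
     (let W = {u. (v, u) \<in> (adj_rel {e \<in> edges T. root T \<notin> e})\<^sup>*}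
      in \<lparr>verts = W, edges = {e \<in> edges T. e \<subseteq> W}, root = v\<rparr>)"

lemma card_branch_less:
  assumes "rooted_tree T" and "{root T, v} \<in> edges T"
  shows "card (verts (branch T v)) < card (verts T)"
proof -
  let ?R = "adj_rel {e \<in> edges T. root T \<notin> e}"
  have fin: "finite (verts T)" and r: "root T \<in> verts T"
    and e: "\<And>e. e \<in> edges T \<Longrightarrow> e \<subseteq> verts T \<and> card e = 2"
    using assms(1) by (auto simp: rooted_tree_def simple_graph_def)
  have v: "v \<in> verts T - {root T}"
    using e[OF assms(2)] by (auto simp: card_2_iff doubleton_eq_iff)
  have "u \<in> verts T - {root T}" if "(v, u) \<in> ?R\<^sup>*" for u
    using that
  proof (induction rule: rtrancl_induct)
    case base
    then show ?case by (rule v)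
  next
    case (step y z)
    then show ?case using e by (auto simp: adj_rel_def)
  qed
  then have "verts (branch T v) \<subseteq> verts T - {root T}"
    by (auto simp: branch_def Let_def)
  then have "verts (branch T v) \<subset> verts T"
    using r by blast
  then show ?thesis
    using fin by (rule psubset_card_mono[rotated])
qed

text \<open>\<open>enumerate\<close> counts from 0, so that \<open>nth_prime 1 = 2\<close>; the value at 0 is junk.\<close>

definition nth_prime :: "nat \<Rightarrow> nat" where
  "nth_prime m = enumerate {p. prime p} (m - 1)"

definition Omega :: "nat \<Rightarrow> nat" where
  "Omega n = size (prime_factorization n)"

text \<open>The one-vertex tree gets the empty product 1. The value 0 for graphs that are not rooted
  trees is junk; no rooted tree has Matula number 0.\<close>

function matula :: "'a rgraph \<Rightarrow> nat" where
  "matula T = (if rooted_tree T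
     then \<Prod>v\<in>{v. {root T, v} \<in> edges T}. nth_prime (matula (branch T v)) else 0)"
  by pat_completeness auto
termination
  by (relation "measure (\<lambda>T. card (verts T))") (auto intro: card_branch_less)

declare matula.simps [simp del]

text \<open>The rooted tree with Matula number \<open>n\<close> is unique only up to isomorphism; \<open>\<tau> n\<close> is
  a representative with natural numbers as vertices.\<close>

definition \<tau> :: "nat \<Rightarrow> nat rgraph" where
  "\<tau> n = (SOME T. rooted_tree T \<and> matula T = n)"

definition degree :: "'a rgraph \<Rightarrow> 'a \<Rightarrow> nat" where
  "degree T i = card {e \<in> edges T. i \<in> e}"

definition zagreb1 :: "'a rgraph \<Rightarrow> nat" where
  "zagreb1 T = (\<Sum>i\<in>verts T. (degree T i)\<^sup>2)"

definition Z1 :: "nat \<Rightarrow> nat" where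
  "Z1 n = zagreb1 (\<tau> n)"

end

theory Submission
  imports Defs
begin

text \<open>
  Deleting the root of a rooted tree \<open>T\<close> leaves its branches. A vertex of a branch has the same
  degree there as in \<open>T\<close>, except that the root of the branch loses one edge. If the branches are
  \<open>B\<^sub>1, \<dots>, B\<^sub>d\<close>, with root degrees \<open>k\<^sub>1, \<dots>, k\<^sub>d\<close>, then \<open>(k\<^sub>i + 1)\<^sup>2 = k\<^sub>i\<^sup>2 + 2k\<^sub>i + 1\<close> shows that
  the first Zagreb index of \<open>T\<close> is \<open>d\<^sup>2\<close> plus the sum over \<open>i\<close> of the index of \<open>B\<^sub>i\<close> plus
  \<open>2k\<^sub>i + 1\<close> (\<open>zagreb1_decomp\<close>). The prime factors of the Matula number of \<open>T\<close> are the primes whose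
  indices are the Matula numbers of the branches; in particular the root has degree
  \<open>\<Omega>(\<mu>(T))\<close>. So the index is given by a recursion over prime factors alone, which defines the
  arithmetic function \<open>zagreb_of\<close>, and two trees with the same Matula number have the same index
  (\<open>zagreb1_eq_zagreb_of_matula\<close>). Hence the index of \<open>\<tau> n\<close> is the same
  whichever tree with number \<open>n\<close> is chosen, and isomorphisms do not enter the argument.

  Existence is what remains: \<open>\<tau> n\<close> is meaningful only if some tree has Matula number \<open>n\<close>.
  Joining the root of a tree with number \<open>m\<close> by an edge to the root of a disjoint tree with
  number \<open>t\<close> gives a tree with number \<open>m\<close> times the \<open>t\<close>-th prime (\<open>matula_graft\<close>). Every
  \<open>n > 1\<close> has this form with \<open>m, t < n\<close>, so induction applies (\<open>ex_tree_with_matula\<close>).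

  The stated recursion for \<open>Z1\<close> is then a property of \<open>zagreb_of\<close>: apart from the term
  \<open>\<Omega>(n)\<^sup>2\<close> this function is a sum over prime factors, hence additive on products.
\<close>

section \<open>Primes and their indices\<close>

lemma infinite_primes: "infinite {p::nat. prime p}"
  using primes_infinite by simp

lemma prime_nth_prime: "prime (nth_prime m)"
  using enumerate_in_set[OF infinite_primes, of "m - 1"] by (simp add: nth_prime_def)

lemma nth_prime_inject:
  assumes "a \<ge> 1" "b \<ge> 1" "nth_prime a = nth_prime b"
  shows "a = b"
proof -
  have "inj (enumerate {p::nat. prime p})"
    using strict_mono_enumerate[OF infinite_primes] by (rule strict_mono_imp_inj_on)
  then have "a - 1 = b - 1"
    using assms(3) by (auto simp: nth_prime_def dest: injD)
  then show ?thesis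
    using assms(1,2) by linarith
qed

lemma prime_is_nth_prime:
  assumes "prime (p::nat)"
  obtains t where "t \<ge> 1" "p = nth_prime t"
proof -
  obtain k where "enumerate {p. prime p} k = p"
    using enumerate_Ex[OF infinite_primes, of p] assms by auto
  then show thesis
    using that[of "Suc k"] by (simp add: nth_prime_def)
qed

text \<open>The inequality is strict, so that passing from a prime to its index makes numbers smaller:
  this drives both the recursion of \<open>zagreb_of\<close> and the construction of trees.\<close>

lemma less_nth_prime:
  assumes "t \<ge> 1"
  shows "t < nth_prime t"
proof -
  have "k + 2 \<le> enumerate {p::nat. prime p} k" for k
  proof (induction k)
    case 0
    then show ?case
      using prime_nth_prime[of 1, THEN prime_ge_2_nat] by (simp add: nth_prime_def)
  next
    case (Suc k)
    then show ?case
      using enumerate_step[OF infinite_primes, of k] by linarith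
  qed
  from this[of "t - 1"] show ?thesis
    using assms by (simp add: nth_prime_def)
qed

definition prime_index :: "nat \<Rightarrow> nat" where
  "prime_index p = (THE t. t \<ge> 1 \<and> nth_prime t = p)"

lemma prime_index_nth_prime: "t \<ge> 1 \<Longrightarrow> prime_index (nth_prime t) = t"
  unfolding prime_index_def by (rule the_equality) (auto intro: nth_prime_inject)

lemma prime_index_less:
  assumes "p \<in># prime_factorization n"
  shows "prime_index p < n"
proof -
  have "prime p" "p \<le> n"
    using assms by (auto simp: in_prime_factors_iff intro: dvd_imp_le)
  then show ?thesis
    using less_nth_prime prime_index_nth_prime
    by (metis prime_is_nth_prime order_less_le_trans)
qed

text \<open>The value at \<open>n\<close> will be the first Zagreb index of every rooted tree with Matula number \<open>n\<close>.
  The term of a prime factor \<open>p\<close> is the contribution of the branch that belongs to \<open>p\<close>: its own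
  index, corrected for the additional edge at its root.\<close>

function zagreb_of :: "nat \<Rightarrow> nat" where
  "zagreb_of n = (Omega n)\<^sup>2 +
     (\<Sum>p\<in>#prime_factorization n. zagreb_of (prime_index p) + 2 * Omega (prime_index p) + 1)"
  by pat_completeness auto
termination
  by (relation "measure id") (simp_all only: in_measure id_apply wf_measure prime_index_less)

declare zagreb_of.simps [simp del]

lemma zagreb_of_nth_prime:
  assumes "t \<ge> 1"
  shows "zagreb_of (nth_prime t) = zagreb_of t + 2 + 2 * Omega t"
  using assms prime_nth_prime[of t]
  by (subst zagreb_of.simps) (simp add: prime_factorization_prime Omega_def prime_index_nth_prime)

text \<open>Prime factorizations add up, so the difference \<open>zagreb_of n - (Omega n)\<^sup>2\<close> is additive. The
  equation is arranged to avoid subtraction on the natural numbers.\<close>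

lemma zagreb_of_mult:
  assumes "r \<ge> 1" "s \<ge> 1"
  shows "zagreb_of (r * s) + (Omega r)\<^sup>2 + (Omega s)\<^sup>2 =
    zagreb_of r + zagreb_of s + (Omega (r * s))\<^sup>2"
proof -
  have "prime_factorization (r * s) = prime_factorization r + prime_factorization s"
    using assms by (intro prime_factorization_mult) auto
  then show ?thesis
    unfolding zagreb_of.simps[of "r * s"] zagreb_of.simps[of r] zagreb_of.simps[of s]
    by simp
qed

section \<open>Acyclicity and bridges\<close>

lemma sym_adj_rel: "sym (adj_rel E)"
  by (auto simp: adj_rel_def sym_def insert_commute)

lemma adj_rel_rtrancl_sym: "(u, v) \<in> (adj_rel E)\<^sup>* \<Longrightarrow> (v, u) \<in> (adj_rel E)\<^sup>*"
  using sym_rtrancl[OF sym_adj_rel] by (rule symD)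

lemma adj_rel_rtrancl_mono: "E \<subseteq> F \<Longrightarrow> (u, v) \<in> (adj_rel E)\<^sup>* \<Longrightarrow> (u, v) \<in> (adj_rel F)\<^sup>*"
  using rtrancl_mono[of "adj_rel E" "adj_rel F"] by (auto simp: adj_rel_def)

text \<open>Extending a path at its front may hit the path again; the loop that this closes is cut off.\<close>

lemma rtrancl_imp_distinct_path:
  assumes "(u, v) \<in> R\<^sup>*"
  shows "\<exists>xs. xs \<noteq> [] \<and> hd xs = u \<and> last xs = v \<and> distinct xs \<and> successively (\<lambda>a b. (a, b) \<in> R) xs"
  using assms
proof (induction rule: converse_rtrancl_induct)
  case base
  show ?case by (rule exI[of _ "[v]"]) simp
next
  case (step y z)
  then obtain xs where xs: "xs \<noteq> []" "hd xs = z" "last xs = v" "distinct xs"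
      "successively (\<lambda>a b. (a, b) \<in> R) xs"
    by blast
  show ?case
  proof (cases "y \<in> set xs")
    case True
    then obtain ps qs where "xs = ps @ y # qs"
      by (auto dest: split_list)
    then show ?thesis
      using xs by (intro exI[of _ "y # qs"]) (auto simp: successively_append_iff)
  next
    case False
    then show ?thesis
      using xs step(1) by (intro exI[of _ "y # xs"]) (auto simp: successively_Cons)
  qed
qed

lemma successively_imp_rtrancl:
  assumes "xs \<noteq> []" "successively (\<lambda>a b. (a, b) \<in> R) xs"
  shows "(hd xs, last xs) \<in> R\<^sup>*"
  using assms
  by (induction xs rule: induct_list012) (auto intro: converse_rtrancl_into_rtrancl)

text \<open>A map that sends each step to a step or to a single point sends paths to paths. It is used for
  the map that contracts one of two trees joined by an edge.\<close>

lemma rtrancl_contract: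
  assumes "(u, v) \<in> R\<^sup>*"
    and "\<And>y z. (y, z) \<in> R \<Longrightarrow> f y = f z \<or> (f y, f z) \<in> S"
  shows "(f u, f v) \<in> S\<^sup>*"
  using assms(1)
proof induction
  case (step y z)
  then show ?case
    using assms(2)[of y z] by (auto intro: rtrancl_into_rtrancl)
qed simp

text \<open>A path between the ends of an edge that avoids this edge closes up to a cycle, and conversely a
  cycle without its closing edge is such a path. The condition about bridges concerns only
  reachability, so cycles as vertex lists need not be handled when trees are cut or joined.\<close>

lemma acyclic_iff_bridges:
  assumes loopfree: "\<And>u. {u} \<notin> E"
  shows "(\<nexists>xs. is_cycle E xs) \<longleftrightarrow>
    (\<forall>u v. {u, v} \<in> E \<longrightarrow> (u, v) \<notin> (adj_rel (E - {{u, v}}))\<^sup>*)" (is "?A \<longleftrightarrow> ?B")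
proof
  assume A: ?A
  show ?B
  proof (intro allI impI notI)
    fix u v assume e: "{u, v} \<in> E" and "(u, v) \<in> (adj_rel (E - {{u, v}}))\<^sup>*"
    then obtain xs where xs: "xs \<noteq> []" "hd xs = u" "last xs = v" "distinct xs"
        "successively (\<lambda>a b. (a, b) \<in> adj_rel (E - {{u, v}})) xs"
      using rtrancl_imp_distinct_path by metis
    have "u \<noteq> v"
      using e loopfree by auto
    obtain a ys where a: "xs = a # ys"
      using xs(1) by (cases xs) auto
    obtain b zs where b: "ys = b # zs"
      using xs \<open>u \<noteq> v\<close> a by (cases ys) auto
    \<comment> \<open>A path with only two vertices would use the removed edge.\<close>
    have "zs \<noteq> []"
      using xs a b by (auto simp: adj_rel_def)
    then have "length xs \<ge> 3"
      using a b by (cases zs) auto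
    moreover have "{xs ! i, xs ! Suc i} \<in> E" if "Suc i < length xs" for i
      using xs(5) that by (auto simp: successively_conv_nth adj_rel_def)
    ultimately have "is_cycle E xs"
      using xs e by (auto simp: is_cycle_def insert_commute)
    then show False
      using A by blast
  qed
next
  assume B: ?B
  show ?A
  proof
    assume "\<exists>xs. is_cycle E xs"
    then obtain xs where xs: "length xs \<ge> 3" "distinct xs"
        "\<And>i. Suc i < length xs \<Longrightarrow> {xs ! i, xs ! Suc i} \<in> E" "{last xs, hd xs} \<in> E"
      by (auto simp: is_cycle_def)
    let ?n = "length xs - 1"
    have ne: "xs \<noteq> []" using xs(1) by auto
    have ends: "hd xs = xs ! 0" "last xs = xs ! ?n"
      using ne by (auto simp: hd_conv_nth last_conv_nth)
    \<comment> \<open>The closing edge is not a step of the path: the list is distinct and longer than two.\<close>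
    have "{xs ! i, xs ! Suc i} \<noteq> {hd xs, last xs}" if "Suc i < length xs" for i
      using that xs(1,2) ne unfolding ends
      by (auto simp: doubleton_eq_iff nth_eq_iff_index_eq)
    then have "successively (\<lambda>a b. (a, b) \<in> adj_rel (E - {{hd xs, last xs}})) xs"
      using xs(3) by (auto simp: successively_conv_nth adj_rel_def)
    from successively_imp_rtrancl[OF ne this] show False
      using B[rule_format, of "hd xs" "last xs"] xs(4) by (simp add: insert_commute)
  qed
qed

section \<open>Decomposition of a rooted tree into its branches\<close>

locale tree =
  fixes T :: "'a rgraph"
  assumes rooted_tree: "rooted_tree T"
begin

lemma finite_verts: "finite (verts T)"
  and root_in: "root T \<in> verts T"
  and edge_subset: "e \<in> edges T \<Longrightarrow> e \<subseteq> verts T"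
  and edge_card: "e \<in> edges T \<Longrightarrow> card e = 2"
  and reachable: "u \<in> verts T \<Longrightarrow> v \<in> verts T \<Longrightarrow> (u, v) \<in> (adj_rel (edges T))\<^sup>*"
  using rooted_tree by (auto simp: rooted_tree_def simple_graph_def connected_graph_def)

lemma loopfree: "{u} \<notin> edges T"
  using edge_card by fastforce

lemma bridge: "{u, v} \<in> edges T \<Longrightarrow> (u, v) \<notin> (adj_rel (edges T - {{u, v}}))\<^sup>*"
  using rooted_tree acyclic_iff_bridges[of "edges T"] loopfree by (auto simp: rooted_tree_def)

lemma finite_edges: "finite (edges T)"
  by (rule finite_subset[of _ "Pow (verts T)"]) (use edge_subset finite_verts in auto)

definition "children = {v. {root T, v} \<in> edges T}"

lemma children_subset: "children \<subseteq> verts T - {root T}"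
  using edge_subset loopfree by (auto simp: children_def)

lemma finite_children: "finite children"
  using children_subset finite_verts by (auto intro: finite_subset)

lemma verts_branch:
  "verts (branch T v) = {u. (v, u) \<in> (adj_rel {e \<in> edges T. root T \<notin> e})\<^sup>*}"
  and edges_branch: "edges (branch T v) = {e \<in> edges T. e \<subseteq> verts (branch T v)}"
  and root_branch: "root (branch T v) = v"
  by (simp_all add: branch_def Let_def)

lemma self_in_branch: "v \<in> verts (branch T v)"
  by (simp add: verts_branch)

lemma branch_subset:
  assumes "v \<in> children"
  shows "verts (branch T v) \<subseteq> verts T - {root T}"
proof
  fix u assume "u \<in> verts (branch T v)"
  then have "(v, u) \<in> (adj_rel {e \<in> edges T. root T \<notin> e})\<^sup>*"
    by (simp add: verts_branch)
  then show "u \<in> verts T - {root T}"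
    by induction (use assms children_subset edge_subset in \<open>auto simp: adj_rel_def\<close>)
qed

lemma branch_closed:
  assumes "u \<in> verts (branch T v)" "{u, w} \<in> edges T" "u \<noteq> root T" "w \<noteq> root T"
  shows "w \<in> verts (branch T v)"
  using assms by (auto simp: verts_branch adj_rel_def intro: rtrancl_into_rtrancl)

text \<open>If two branches met, one could go from the root to \<open>w\<close>, through the common vertex and on to
  \<open>v\<close> without the edge from the root to \<open>v\<close>, which is a bridge.\<close>

lemma branches_disjoint:
  assumes "v \<in> children" "w \<in> children" "u \<in> verts (branch T v)" "u \<in> verts (branch T w)"
  shows "v = w"
proof (rule ccontr)
  assume "v \<noteq> w"
  let ?E = "edges T - {{root T, v}}"
  have "(w, u) \<in> (adj_rel {e \<in> edges T. root T \<notin> e})\<^sup>*"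
    "(u, v) \<in> (adj_rel {e \<in> edges T. root T \<notin> e})\<^sup>*"
    using assms(3,4) by (auto simp: verts_branch intro: adj_rel_rtrancl_sym)
  then have "(w, v) \<in> (adj_rel {e \<in> edges T. root T \<notin> e})\<^sup>*"
    by (rule rtrancl_trans)
  then have "(w, v) \<in> (adj_rel ?E)\<^sup>*"
    by (rule adj_rel_rtrancl_mono[rotated]) auto
  moreover have "(root T, w) \<in> adj_rel ?E"
    using assms(2) \<open>v \<noteq> w\<close> by (auto simp: adj_rel_def children_def doubleton_eq_iff)
  ultimately have "(root T, v) \<in> (adj_rel ?E)\<^sup>*"
    by (rule converse_rtrancl_into_rtrancl[rotated])
  then show False
    using bridge assms(1) by (auto simp: children_def)
qed

text \<open>On a path from the root, a step away from the root enters a branch, and any other step stays in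
  the current branch or returns to the root.\<close>

lemma verts_decomp: "verts T = insert (root T) (\<Union>v\<in>children. verts (branch T v))"
proof (rule antisym)
  show "verts T \<subseteq> insert (root T) (\<Union>v\<in>children. verts (branch T v))"
  proof
    fix u assume "u \<in> verts T"
    then have "(root T, u) \<in> (adj_rel (edges T))\<^sup>*"
      by (rule reachable[OF root_in])
    then show "u \<in> insert (root T) (\<Union>v\<in>children. verts (branch T v))"
    proof induction
      case (step y z)
      then have e: "{y, z} \<in> edges T" by (simp add: adj_rel_def)
      show ?case
      proof (cases "y = root T")
        case True
        then have "z \<in> children" using e by (simp add: children_def)
        then show ?thesis using self_in_branch by auto
      next
        case False
        then show ?thesis using step.IH e branch_closed by blast
      qed
    qed simp
  qed
  show "insert (root T) (\<Union>v\<in>children. verts (branch T v)) \<subseteq> verts T"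
    using branch_subset root_in by auto
qed

lemma rooted_tree_branch:
  assumes "v \<in> children"
  shows "rooted_tree (branch T v)"
proof -
  let ?W = "verts (branch T v)" and ?F = "edges (branch T v)"
  have sub: "?W \<subseteq> verts T - {root T}"
    by (rule branch_subset[OF assms])
  have "simple_graph ?W ?F"
    using edge_card sub finite_verts
    by (auto simp: simple_graph_def edges_branch intro: finite_subset)
  moreover have "connected_graph ?W ?F"
  proof -
    have from_v: "(v, u) \<in> (adj_rel ?F)\<^sup>*" if "u \<in> ?W" for u
    proof -
      have "(v, u) \<in> (adj_rel {e \<in> edges T. root T \<notin> e})\<^sup>*"
        using that by (simp add: verts_branch)
      then show ?thesis
      proof induction
        case (step y z)
        have y: "y \<in> ?W" using step(1) by (simp add: verts_branch)
        have e: "{y, z} \<in> edges T" "z \<noteq> root T" using step(2) by (auto simp: adj_rel_def)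
        then have "z \<in> ?W"
          using branch_closed[OF y] y sub by auto
        then have "(y, z) \<in> adj_rel ?F"
          using y e by (simp add: adj_rel_def edges_branch)
        then show ?case using step.IH by (rule rtrancl_into_rtrancl[rotated])
      qed simp
    qed
    have "(u, w) \<in> (adj_rel ?F)\<^sup>*" if "u \<in> ?W" "w \<in> ?W" for u w
      using adj_rel_rtrancl_sym[OF from_v[OF that(1)]] from_v[OF that(2)] by (rule rtrancl_trans)
    then show ?thesis
      using self_in_branch by (auto simp: connected_graph_def)
  qed
  moreover have "\<nexists>xs. is_cycle ?F xs"
    using rooted_tree by (auto simp: rooted_tree_def is_cycle_def edges_branch)
  ultimately show ?thesis
    using self_in_branch by (simp add: rooted_tree_def root_branch)
qed

lemma degree_root: "degree T (root T) = card children"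
proof -
  have "{e \<in> edges T. root T \<in> e} = (\<lambda>v. {root T, v}) ` children"
  proof (intro equalityI subsetI)
    fix e assume e: "e \<in> {e \<in> edges T. root T \<in> e}"
    then obtain v where "e = {root T, v}"
      using edge_card[of e] by (auto simp: card_2_iff)
    then show "e \<in> (\<lambda>v. {root T, v}) ` children"
      using e by (auto simp: children_def)
  qed (auto simp: children_def)
  moreover have "inj_on (\<lambda>v. {root T, v}) children"
    by (auto simp: inj_on_def doubleton_eq_iff)
  ultimately show ?thesis
    by (simp add: degree_def card_image)
qed

text \<open>An edge at \<open>u\<close> that avoids the root stays inside the branch. An edge from \<open>u\<close> to the root makes
  \<open>u\<close> a child with a branch of its own, which meets that of \<open>v\<close>, so \<open>u = v\<close>.\<close>

lemma degree_in_branch: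
  assumes v: "v \<in> children" and u: "u \<in> verts (branch T v)"
  shows "degree T u = degree (branch T v) u + (if u = v then 1 else 0)"
proof -
  let ?B = "branch T v"
  have sub: "verts ?B \<subseteq> verts T - {root T}"
    by (rule branch_subset[OF v])
  have ur: "u \<noteq> root T" using sub u by auto
  have inner: "e \<subseteq> verts ?B" if e: "e \<in> edges T" "u \<in> e" "root T \<notin> e" for e
  proof -
    obtain w where "e = {u, w}"
      using edge_card[OF e(1)] e(2) by (auto simp: card_2_iff)
    then show ?thesis using branch_closed[OF u] e u ur by auto
  qed
  have outer: "e = {root T, v} \<and> u = v" if "e \<in> edges T" "u \<in> e" "root T \<in> e" for e
  proof -
    have e: "e = {root T, u}"
      using edge_card[OF that(1)] that(2,3) ur by (auto simp: card_2_iff)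
    then have "u \<in> children" using that by (simp add: children_def)
    then have "u = v" using branches_disjoint[OF _ v self_in_branch u] by simp
    then show ?thesis using e by simp
  qed
  have "{e \<in> edges T. u \<in> e} =
      {e \<in> edges ?B. u \<in> e} \<union> (if u = v then {{root T, v}} else {})"
  proof (intro equalityI subsetI)
    fix e assume "e \<in> {e \<in> edges T. u \<in> e}"
    then show "e \<in> {e \<in> edges ?B. u \<in> e} \<union> (if u = v then {{root T, v}} else {})"
      using inner[of e] outer[of e] by (cases "root T \<in> e") (auto simp: edges_branch)
  qed (use v in \<open>auto simp: edges_branch children_def split: if_splits\<close>)
  moreover have "{root T, v} \<notin> edges ?B"
    using sub by (auto simp: edges_branch)
  moreover have "finite (edges ?B)"
    using finite_edges by (simp add: edges_branch)
  ultimately show ?thesis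
    by (auto simp: degree_def)
qed

lemma zagreb1_decomp:
  "zagreb1 T = (card children)\<^sup>2 +
     (\<Sum>v\<in>children. zagreb1 (branch T v) + 2 * degree (branch T v) v + 1)"
proof -
  have fin: "finite (verts (branch T v))" if "v \<in> children" for v
    using branch_subset[OF that] finite_verts by (auto intro: finite_subset)
  have each: "(\<Sum>u\<in>verts (branch T v). (degree T u)\<^sup>2) =
      zagreb1 (branch T v) + 2 * degree (branch T v) v + 1" if v: "v \<in> children" for v
  proof -
    let ?B = "branch T v"
    have "(\<Sum>u\<in>verts ?B. (degree T u)\<^sup>2) =
        (\<Sum>u\<in>verts ?B. (degree ?B u)\<^sup>2 + (if u = v then 2 * degree ?B v + 1 else 0))"
      by (rule sum.cong) (auto simp: degree_in_branch[OF v] power2_eq_square algebra_simps)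
    also have "\<dots> = zagreb1 ?B + 2 * degree ?B v + 1"
      using fin[OF v] self_in_branch by (simp add: sum.distrib zagreb1_def)
    finally show ?thesis .
  qed
  have "zagreb1 T = (degree T (root T))\<^sup>2 +
      (\<Sum>u\<in>(\<Union>v\<in>children. verts (branch T v)). (degree T u)\<^sup>2)"
    unfolding zagreb1_def
    by (subst verts_decomp, rule sum.insert) (use fin finite_children branch_subset in auto)
  also have "(\<Sum>u\<in>(\<Union>v\<in>children. verts (branch T v)). (degree T u)\<^sup>2) =
      (\<Sum>v\<in>children. \<Sum>u\<in>verts (branch T v). (degree T u)\<^sup>2)"
    by (rule sum.UNION_disjoint) (use fin finite_children branches_disjoint in blast)+
  finally show ?thesis
    by (simp add: degree_root each)
qed

lemma matula_decomp: "matula T = (\<Prod>v\<in>children. nth_prime (matula (branch T v)))"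
  using rooted_tree by (simp add: matula.simps[of T] children_def)

lemma matula_pos: "matula T \<ge> 1"
  unfolding matula_decomp
  by (rule prod_ge_1) (use prime_nth_prime prime_ge_1_nat in blast)

lemma prime_factorization_matula:
  "prime_factorization (matula T) =
     image_mset (\<lambda>v. nth_prime (matula (branch T v))) (mset_set children)"
proof -
  have "matula T = prod_mset (image_mset (\<lambda>v. nth_prime (matula (branch T v))) (mset_set children))"
    by (simp add: matula_decomp prod_unfold_prod_mset)
  then show ?thesis
    by (auto simp: prime_nth_prime intro!: prime_factorization_prod_mset_primes)
qed

lemma Omega_matula: "Omega (matula T) = degree T (root T)"
  by (simp add: Omega_def prime_factorization_matula degree_root)

end

text \<open>Induction over the number of vertices, since each branch is a smaller rooted tree. The index of a
  tree and \<open>zagreb_of\<close> of its Matula number decompose in the same way, one summand per child of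
  the root and one per prime factor.\<close>

lemma zagreb1_eq_zagreb_of_matula:
  "rooted_tree T \<Longrightarrow> zagreb1 T = zagreb_of (matula T)"
proof (induction "card (verts T)" arbitrary: T rule: less_induct)
  case less
  interpret tree T by unfold_locales (rule less.prems)
  have branch: "zagreb1 (branch T v) + 2 * degree (branch T v) v + 1 =
      zagreb_of (prime_index (nth_prime (matula (branch T v)))) +
      2 * Omega (prime_index (nth_prime (matula (branch T v)))) + 1" if v: "v \<in> children" for v
  proof -
    interpret B: tree "branch T v" by unfold_locales (rule rooted_tree_branch[OF v])
    have "card (verts (branch T v)) < card (verts T)"
      using card_branch_less[OF rooted_tree] v by (simp add: children_def)
    then have "zagreb1 (branch T v) = zagreb_of (matula (branch T v))"
      using less.hyps B.rooted_tree by blast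
    then show ?thesis
      using B.Omega_matula B.matula_pos by (simp add: prime_index_nth_prime root_branch)
  qed
  have "zagreb_of (matula T) = (card children)\<^sup>2 +
      (\<Sum>v\<in>children. zagreb_of (prime_index (nth_prime (matula (branch T v)))) +
        2 * Omega (prime_index (nth_prime (matula (branch T v)))) + 1)"
    by (subst zagreb_of.simps)
      (simp add: prime_factorization_matula Omega_matula degree_root sum_unfold_sum_mset
        image_mset.compositionality comp_def)
  also have "\<dots> = zagreb1 T"
    unfolding zagreb1_decomp by (simp only: branch cong: sum.cong)
  finally show ?case
    by (rule sym)
qed

section \<open>Every positive integer is a Matula number\<close>

lemma rooted_tree_singleton:
  "rooted_tree \<lparr>verts = {x}, edges = {}, root = x\<rparr>"
  by (auto simp: rooted_tree_def simple_graph_def connected_graph_def is_cycle_def)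

definition graft :: "'a rgraph \<Rightarrow> 'a rgraph \<Rightarrow> 'a rgraph" where
  "graft A B = \<lparr>verts = verts A \<union> verts B,
     edges = insert {root A, root B} (edges A \<union> edges B), root = root A\<rparr>"

text \<open>Planting a tree under a new root and merging two trees at their roots are both obtained by
  repeated grafting; one graft adds a single prime factor to the Matula number of the first tree.\<close>

locale grafting = A: tree A + B: tree B for A B :: "'a rgraph" +
  assumes disjoint: "verts A \<inter> verts B = {}"
begin

lemma edge_A: "{x, y} \<in> edges A \<Longrightarrow> x \<in> verts A \<and> y \<in> verts A"
  and edge_B: "{x, y} \<in> edges B \<Longrightarrow> x \<in> verts B \<and> y \<in> verts B"
  using A.edge_subset B.edge_subset by auto

lemma disj: "x \<in> verts A \<Longrightarrow> x \<in> verts B \<Longrightarrow> False"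
  using disjoint by auto

text \<open>The new edge is a bridge because without it no path leaves the first tree. A detour around an old
  edge is turned by contraction into a detour within the tree that contains the edge.\<close>

lemma graft_bridge:
  assumes "{u, v} \<in> edges (graft A B)"
  shows "(u, v) \<notin> (adj_rel (edges (graft A B) - {{u, v}}))\<^sup>*"
proof
  let ?E = "edges (graft A B)"
  assume path: "(u, v) \<in> (adj_rel (?E - {{u, v}}))\<^sup>*"
  consider "{u, v} = {root A, root B}" | "{u, v} \<in> edges A" | "{u, v} \<in> edges B"
    using assms by (auto simp: graft_def)
  then show False
  proof cases
    case 1
    have stay: "z \<in> verts A" if "(root A, z) \<in> (adj_rel (?E - {{root A, root B}}))\<^sup>*" for z
      using that
    proof induction
      case base
      then show ?case by (rule A.root_in)
    next
      case (step y z)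
      then show ?case
        using edge_A[of y z] edge_B[of y z] disj by (auto simp: adj_rel_def graft_def)
    qed
    have "(root A, root B) \<in> (adj_rel (?E - {{root A, root B}}))\<^sup>*"
      using 1 path adj_rel_rtrancl_sym[OF path] by (auto simp: doubleton_eq_iff insert_commute)
    then show False
      using stay disj B.root_in by blast
  next
    case 2
    \<comment> \<open>Contract the other tree to the root of the tree that contains the edge.\<close>
    define f where "f x = (if x \<in> verts B then root A else x)" for x
    have "f y = f z \<or> (f y, f z) \<in> adj_rel (edges A - {{u, v}})"
      if "(y, z) \<in> adj_rel (?E - {{u, v}})" for y z
      using that edge_A[of y z] edge_B[of y z] disj A.root_in B.root_in
      by (auto simp: adj_rel_def graft_def f_def doubleton_eq_iff)
    from rtrancl_contract[where f = f, OF path this] have "(u, v) \<in> (adj_rel (edges A - {{u, v}}))\<^sup>*"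
      using edge_A[OF 2] disj by (auto simp: f_def split: if_splits)
    then show False
      using A.bridge[OF 2] by simp
  next
    case 3
    define f where "f x = (if x \<in> verts A then root B else x)" for x
    have "f y = f z \<or> (f y, f z) \<in> adj_rel (edges B - {{u, v}})"
      if "(y, z) \<in> adj_rel (?E - {{u, v}})" for y z
      using that edge_A[of y z] edge_B[of y z] disj A.root_in B.root_in
      by (auto simp: adj_rel_def graft_def f_def doubleton_eq_iff)
    from rtrancl_contract[where f = f, OF path this] have "(u, v) \<in> (adj_rel (edges B - {{u, v}}))\<^sup>*"
      using edge_B[OF 3] disj by (auto simp: f_def split: if_splits)
    then show False
      using B.bridge[OF 3] by simp
  qed
qed

lemma rooted_tree_graft: "rooted_tree (graft A B)"
proof -
  let ?G = "graft A B"
  have ne: "root A \<noteq> root B"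
    using A.root_in B.root_in disj by metis
  have "simple_graph (verts ?G) (edges ?G)"
    using A.finite_verts B.finite_verts A.edge_subset B.edge_subset A.edge_card B.edge_card
      A.root_in B.root_in ne
    by (auto simp: simple_graph_def graft_def)
  moreover have "connected_graph (verts ?G) (edges ?G)"
  proof -
    have from_root: "(root A, u) \<in> (adj_rel (edges ?G))\<^sup>*" if "u \<in> verts ?G" for u
    proof (cases "u \<in> verts A")
      case True
      then show ?thesis
        using A.reachable[OF A.root_in] 
        by (auto simp: graft_def intro: adj_rel_rtrancl_mono[of "edges A"])
    next
      case False
      then have "(root B, u) \<in> (adj_rel (edges ?G))\<^sup>*"
        using that B.reachable[OF B.root_in]
        by (auto simp: graft_def intro: adj_rel_rtrancl_mono[of "edges B"])
      moreover have "(root A, root B) \<in> adj_rel (edges ?G)"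
        by (simp add: adj_rel_def graft_def)
      ultimately show ?thesis by (rule converse_rtrancl_into_rtrancl[rotated])
    qed
    have "(u, w) \<in> (adj_rel (edges ?G))\<^sup>*" if "u \<in> verts ?G" "w \<in> verts ?G" for u w
      using adj_rel_rtrancl_sym[OF from_root[OF that(1)]] from_root[OF that(2)]
      by (rule rtrancl_trans)
    then show ?thesis
      using A.root_in by (auto simp: connected_graph_def graft_def)
  qed
  moreover have "\<nexists>xs. is_cycle (edges ?G) xs"
  proof -
    have "{u} \<notin> edges ?G" for u
      using A.loopfree B.loopfree ne by (auto simp: graft_def)
    then show ?thesis
      using graft_bridge acyclic_iff_bridges[of "edges ?G"] by blast
  qed
  ultimately show ?thesis
    using A.root_in by (simp add: rooted_tree_def graft_def)
qed

sublocale G: tree "graft A B"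
  by unfold_locales (rule rooted_tree_graft)

lemma children_graft: "G.children = insert (root B) A.children"
  unfolding G.children_def A.children_def
  using disj[of "root A"] A.root_in edge_B[of "root A"]
  by (auto simp: graft_def doubleton_eq_iff)

text \<open>The branch is equal to \<open>B\<close>, not just isomorphic to it, so that Matula numbers can be
  compared by rewriting.\<close>

lemma branch_graft_root: "branch (graft A B) (root B) = B"
proof -
  let ?R = "adj_rel {e \<in> edges (graft A B). root (graft A B) \<notin> e}"
  have "(root B, u) \<in> ?R\<^sup>* \<longleftrightarrow> u \<in> verts B" for u
  proof
    assume "(root B, u) \<in> ?R\<^sup>*"
    then show "u \<in> verts B"
    proof induction
      case base
      then show ?case by (rule B.root_in)
    next
      case (step y z)
      then show ?case
        using edge_A[of y z] edge_B[of y z] disj by (auto simp: adj_rel_def graft_def)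
    qed
  next
    assume "u \<in> verts B"
    then have "(root B, u) \<in> (adj_rel (edges B))\<^sup>*"
      by (rule B.reachable[OF B.root_in])
    moreover have "edges B \<subseteq> {e \<in> edges (graft A B). root (graft A B) \<notin> e}"
      using B.edge_subset A.root_in disj by (auto simp: graft_def)
    ultimately show "(root B, u) \<in> ?R\<^sup>*"
      by (rule adj_rel_rtrancl_mono[rotated])
  qed
  then have V: "verts (branch (graft A B) (root B)) = verts B"
    by (auto simp: G.verts_branch)
  have "e \<notin> edges A" if "e \<subseteq> verts B" for e
    using that A.edge_subset[of e] A.edge_card[of e] disjoint
    by (metis Int_greatest card.empty subset_empty zero_neq_numeral)
  then have "edges (branch (graft A B) (root B)) = edges B"
    unfolding G.edges_branch V using B.edge_subset A.root_in disj by (auto simp: graft_def)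
  then show ?thesis
    using V G.root_branch by (intro rgraph.equality) auto
qed

lemma branch_graft_child:
  assumes v: "v \<in> A.children"
  shows "branch (graft A B) v = branch A v"
proof -
  let ?R = "adj_rel {e \<in> edges (graft A B). root (graft A B) \<notin> e}"
  let ?S = "adj_rel {e \<in> edges A. root A \<notin> e}"
  have "(v, u) \<in> ?R\<^sup>* \<longleftrightarrow> (v, u) \<in> ?S\<^sup>*" for u
  proof
    assume "(v, u) \<in> ?R\<^sup>*"
    then have "u \<in> verts A \<and> (v, u) \<in> ?S\<^sup>*"
    proof induction
      case base
      then show ?case using v A.children_subset by auto
    next
      case (step y z)
      then have "{y, z} \<in> edges A" "root A \<notin> {y, z}"
        using edge_B[of y z] disj by (auto simp: adj_rel_def graft_def)
      then show ?case
        using step.IH edge_A by (auto simp: adj_rel_def intro: rtrancl_into_rtrancl)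
    qed
    then show "(v, u) \<in> ?S\<^sup>*" by simp
  next
    assume "(v, u) \<in> ?S\<^sup>*"
    then show "(v, u) \<in> ?R\<^sup>*"
      by (rule adj_rel_rtrancl_mono[rotated]) (auto simp: graft_def)
  qed
  then have V: "verts (branch (graft A B) v) = verts (branch A v)"
    by (auto simp: G.verts_branch A.verts_branch)
  have sub: "verts (branch A v) \<subseteq> verts A"
    using A.branch_subset[OF v] by auto
  have "e \<notin> edges B" if "e \<subseteq> verts (branch A v)" for e
    using that sub B.edge_subset[of e] B.edge_card[of e] disjoint
    by (metis Int_greatest card.empty order_trans subset_empty zero_neq_numeral)
  moreover have "root B \<notin> verts (branch A v)"
    using sub B.root_in disj by auto
  ultimately have "edges (branch (graft A B) v) = edges (branch A v)"
    unfolding G.edges_branch A.edges_branch V by (auto simp: graft_def)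
  then show ?thesis
    using V G.root_branch A.root_branch by (intro rgraph.equality) auto
qed

lemma matula_graft: "matula (graft A B) = nth_prime (matula B) * matula A"
proof -
  have "root B \<notin> A.children"
    using A.children_subset B.root_in disj by auto
  then show ?thesis
    using A.finite_children
    by (simp add: G.matula_decomp A.matula_decomp children_graft branch_graft_root
        branch_graft_child)
qed

end

text \<open>The vertices are confined to an arbitrary infinite set, so that the induction hypothesis can
  yield a second tree disjoint from the first. This avoids renaming vertices, which would require
  the invariance of Matula numbers under isomorphism.\<close>

lemma ex_tree_with_matula:
  fixes S :: "'a set"
  assumes "n \<ge> 1" "infinite S"
  shows "\<exists>T. rooted_tree T \<and> matula T = n \<and> verts T \<subseteq> S"
  using assms
proof (induction n arbitrary: S rule: less_induct)
  case (less n)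
  show ?case
  proof (cases "n = 1")
    case True
    obtain x where "x \<in> S"
      using infinite_imp_nonempty[OF less.prems(2)] by blast
    moreover have "matula \<lparr>verts = {x}, edges = {}, root = x\<rparr> = 1"
      using rooted_tree_singleton by (subst matula.simps) simp
    ultimately show ?thesis
      using True rooted_tree_singleton
      by (intro exI[of _ "\<lparr>verts = {x}, edges = {}, root = x\<rparr>"]) auto
  next
    case False
    then obtain p m where p: "prime p" and n: "n = p * m"
      using prime_factor_nat[of n] by (auto simp: dvd_def)
    obtain t where t: "t \<ge> 1" "p = nth_prime t"
      using prime_is_nth_prime[OF p] .
    have "m \<noteq> 0"
      using less.prems(1) n by (intro notI) simp
    then have m: "m \<ge> 1" "m < n"
      using prime_gt_1_nat[OF p] unfolding n by simp_all
    have "t < p"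
      unfolding t(2) by (rule less_nth_prime[OF t(1)])
    also have "p \<le> n"
      unfolding n using m(1) by simp
    finally have tn: "t < n" .
    obtain A where A: "rooted_tree A" "matula A = m" "verts A \<subseteq> S"
      using less.IH[OF m(2,1) less.prems(2)] by blast
    have "finite (verts A)"
      using A(1) by (simp add: rooted_tree_def simple_graph_def)
    then have "infinite (S - verts A)"
      using less.prems(2) by simp
    then obtain B where B: "rooted_tree B" "matula B = t" "verts B \<subseteq> S - verts A"
      using less.IH[OF tn t(1)] by blast
    interpret grafting A B
      using A B by unfold_locales auto
    have "matula (graft A B) = n"
      unfolding matula_graft A(2) B(2) n t(2) ..
    moreover have "verts (graft A B) \<subseteq> S"
      using A(3) B(3) by (auto simp: graft_def)
    ultimately show ?thesis
      using G.rooted_tree by blast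
  qed
qed

lemma Z1_eq_zagreb_of:
  assumes "n \<ge> 1"
  shows "Z1 n = zagreb_of n"
proof -
  have "rooted_tree (\<tau> n) \<and> matula (\<tau> n) = n"
    unfolding \<tau>_def
    by (rule someI_ex) (use ex_tree_with_matula[OF assms infinite_UNIV_nat] in blast)
  then show ?thesis
    using zagreb1_eq_zagreb_of_matula[of "\<tau> n"] by (simp add: Z1_def)
qed

theorem proposition3p19:
  fixes n :: nat
  assumes "n \<ge> 1"
  shows "(n = 1 \<longrightarrow> Z1 n = 0) \<and>
    (\<forall>t\<ge>1. n = nth_prime t \<longrightarrow> Z1 n = Z1 t + 2 + 2 * Omega t) \<and>
    (\<forall>r\<ge>2. \<forall>s\<ge>2. n = r * s \<longrightarrow>
       int (Z1 n) = int (Z1 r) + int (Z1 s) - int (Omega r)^2 - int (Omega s)^2 + int (Omega n)^2)"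
proof (intro conjI allI impI)
  assume "n = 1"
  then show "Z1 n = 0"
    by (simp add: Z1_eq_zagreb_of zagreb_of.simps[of "Suc 0"] Omega_def)
next
  fix t assume "t \<ge> 1" "n = nth_prime t"
  then show "Z1 n = Z1 t + 2 + 2 * Omega t"
    using assms by (simp add: Z1_eq_zagreb_of zagreb_of_nth_prime)
next
  fix r s :: nat assume "r \<ge> 2" "s \<ge> 2" "n = r * s"
  then have "Z1 n + (Omega r)\<^sup>2 + (Omega s)\<^sup>2 = Z1 r + Z1 s + (Omega n)\<^sup>2"
    using zagreb_of_mult[of r s] assms by (simp add: Z1_eq_zagreb_of)
  then have "int (Z1 n + (Omega r)\<^sup>2 + (Omega s)\<^sup>2) = int (Z1 r + Z1 s + (Omega n)\<^sup>2)"
    by (rule arg_cong)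
  then show "int (Z1 n) =
      int (Z1 r) + int (Z1 s) - int (Omega r)^2 - int (Omega s)^2 + int (Omega n)^2"
    by simp
qed

end
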